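(* In the Hilbert space $\ell_2$ with its usual norm $\|\cdot\|_2$ (and $\ell_2^*$ identified with $\ell_2$): (1) For every $\delta>0$ there exists a $C^1$ smooth Lipschitz function $\psi:\ell_2\to\mathbb{R}$ with Lipschitz derivative such that $\sup_{x\in\ell_2}|\psi(x)-\|x\|_2|\le\delta$, $\psi'(x)\neq0$ for all $x\in\ell_2$, and the cone $\mathcal{C}(\psi)$ has empty interior in $\ell_2$. (2) There exists a $C^1$ smooth Lipschitz bump function $b$ on $\ell_2$ with Lipschitz derivative such that $\mathcal{C}(b)$ has empty interior in $\ell_2$ and $b'(x)\neq0$ for every $x$ in the interior of the support of $b$.
   Context: For a differentiable function $f$ on a Banach space $X$, $\mathcal{C}(f)=\{\lambda f'(x): \lambda\ge0,\ x\in X\}\subseteq X^*$ is the cone generated by its set of derivatives. A bump function is a function not identically zero with bounded support, where the support is the closure of the set where it is nonzero. *)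

theory Defs
  imports "HOL-Analysis.Analysis"
begin

typedef l2 = "{f :: nat \<Rightarrow> real. summable (\<lambda>n. (f n)\<^sup>2)}"
  morphisms l2_seq Abs_l2
  by (rule exI[of _ "\<lambda>_. 0"]) simp

setup_lifting type_definition_l2

lemma l2_summable_prod:
  assumes "summable (\<lambda>n. (f n)\<^sup>2)" "summable (\<lambda>n. (g n)\<^sup>2)"
  shows "summable (\<lambda>n. f n * g n :: real)"
proof (rule summable_comparison_test)
  show "\<exists>N. \<forall>n\<ge>N. norm (f n * g n) \<le> (f n)\<^sup>2 + (g n)\<^sup>2"
  proof (intro exI allI impI)
    fix n
    have "2 * \<bar>f n\<bar> * \<bar>g n\<bar> \<le> (f n)\<^sup>2 + (g n)\<^sup>2"
      using sum_squares_bound[of "\<bar>f n\<bar>" "\<bar>g n\<bar>"] by (simp add: power2_eq_square)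
    moreover have "\<bar>f n\<bar> * \<bar>g n\<bar> \<le> 2 * \<bar>f n\<bar> * \<bar>g n\<bar>" by simp
    ultimately show "norm (f n * g n) \<le> (f n)\<^sup>2 + (g n)\<^sup>2"
      by (simp only: real_norm_def abs_mult)
  qed
  show "summable (\<lambda>n. (f n)\<^sup>2 + (g n)\<^sup>2)" using assms by (rule summable_add)
qed

lemma l2_summable_add:
  assumes "summable (\<lambda>n. (f n)\<^sup>2)" "summable (\<lambda>n. (g n)\<^sup>2)"
  shows "summable (\<lambda>n. (f n + g n :: real)\<^sup>2)"
proof -
  have "summable (\<lambda>n. (f n)\<^sup>2 + 2 * (f n * g n) + (g n)\<^sup>2)"
    using assms l2_summable_prod[OF assms]
    by (intro summable_add summable_mult) auto
  moreover have "(\<lambda>n. (f n + g n)\<^sup>2) = (\<lambda>n. (f n)\<^sup>2 + 2 * (f n * g n) + (g n)\<^sup>2)"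
    by (simp add: fun_eq_iff power2_sum mult.assoc)
  ultimately show ?thesis by simp
qed

instantiation l2 :: real_vector
begin
lift_definition zero_l2 :: l2 is "\<lambda>_. 0" by simp
lift_definition plus_l2 :: "l2 \<Rightarrow> l2 \<Rightarrow> l2" is "\<lambda>f g n. f n + g n"
  by (rule l2_summable_add)
lift_definition uminus_l2 :: "l2 \<Rightarrow> l2" is "\<lambda>f n. - f n" by simp
lift_definition minus_l2 :: "l2 \<Rightarrow> l2 \<Rightarrow> l2" is "\<lambda>f g n. f n - g n"
  using l2_summable_add[of _ "\<lambda>n. - _ n"] by simp
lift_definition scaleR_l2 :: "real \<Rightarrow> l2 \<Rightarrow> l2" is "\<lambda>c f n. c * f n"
  by (simp add: power_mult_distrib summable_mult)
instance
proof
  fix a b c :: l2 and r s :: real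
  show "a + b + c = a + (b + c)" by transfer (simp add: add.assoc)
  show "a + b = b + a" by transfer (simp add: add.commute)
  show "0 + a = a" by transfer simp
  show "- a + a = 0" by transfer simp
  show "a - b = a + - b" by transfer simp
  show "r *\<^sub>R (a + b) = r *\<^sub>R a + r *\<^sub>R b" by transfer (simp add: distrib_left)
  show "(r + s) *\<^sub>R a = r *\<^sub>R a + s *\<^sub>R a" by transfer (simp add: distrib_right)
  show "r *\<^sub>R s *\<^sub>R a = (r * s) *\<^sub>R a" by transfer (simp add: mult.assoc)
  show "1 *\<^sub>R a = a" by transfer simp
qed
end

instantiation l2 :: real_inner
begin
lift_definition inner_l2 :: "l2 \<Rightarrow> l2 \<Rightarrow> real" is "\<lambda>f g. \<Sum>n. f n * g n" .
definition norm_l2 :: "l2 \<Rightarrow> real" where "norm_l2 x = sqrt (inner x x)"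
definition sgn_l2 :: "l2 \<Rightarrow> l2" where "sgn_l2 x = x /\<^sub>R norm x"
definition dist_l2 :: "l2 \<Rightarrow> l2 \<Rightarrow> real" where "dist_l2 x y = norm (x - y)"
definition uniformity_l2 :: "(l2 \<times> l2) filter"
  where "uniformity_l2 = (INF e\<in>{0<..}. principal {(x, y). dist x y < e})"
definition open_l2 :: "l2 set \<Rightarrow> bool"
  where "open_l2 U = (\<forall>x\<in>U. \<forall>\<^sub>F (x', y) in uniformity. x' = x \<longrightarrow> y \<in> U)"
instance
proof
  fix x y z :: l2 and r :: real
  show "inner x y = inner y x" by transfer (simp add: mult.commute)
  show "inner (x + y) z = inner x z + inner y z"
    by transfer (simp add: distrib_right suminf_add[symmetric] l2_summable_prod)
  show "inner (r *\<^sub>R x) y = r * inner x y"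
    by transfer (simp add: mult.assoc suminf_mult l2_summable_prod)
  show "0 \<le> inner x x" by transfer (auto intro!: suminf_nonneg simp: power2_eq_square[symmetric])
  show "(inner x x = 0) = (x = 0)"
  proof transfer
    fix f :: "nat \<Rightarrow> real" assume "summable (\<lambda>n. (f n)\<^sup>2)"
    then have "summable (\<lambda>n. f n * f n)" by (simp add: power2_eq_square)
    then show "((\<Sum>n. f n * f n) = 0) = (f = (\<lambda>_. 0))"
      by (subst suminf_eq_zero_iff) (auto simp: fun_eq_iff)
  qed
  show "norm x = sqrt (inner x x)" by (simp only: norm_l2_def)
  show "sgn x = x /\<^sub>R norm x" by (simp only: sgn_l2_def)
  show "dist x y = norm (x - y)" by (simp only: dist_l2_def)
next
  show "(uniformity :: (l2 \<times> l2) filter) = (INF e\<in>{0<..}. principal {(x, y). dist x y < e})"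
    by (simp only: uniformity_l2_def)
next
  fix U :: "l2 set"
  show "open U = (\<forall>x\<in>U. \<forall>\<^sub>F (x', y) in uniformity. x' = x \<longrightarrow> y \<in> U)"
    by (simp only: open_l2_def)
qed
end

text \<open>The cone generated by the derivatives of a differentiable function, where the
  derivative at x is represented (Riesz identification of the dual with l2) by the
  gradient G x, i.e. the derivative is the functional h |-> inner (G x) h.\<close>
definition deriv_cone :: "('a::real_inner \<Rightarrow> 'a) \<Rightarrow> 'a set" where
  "deriv_cone G = {c *\<^sub>R G x | c x. c \<ge> 0}"

definition fsupport :: "('a::topological_space \<Rightarrow> real) \<Rightarrow> 'a set" where
  "fsupport f = closure {x. f x \<noteq> 0}"

definition is_bump :: "('a::metric_space \<Rightarrow> real) \<Rightarrow> bool" where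
  "is_bump f \<longleftrightarrow> (\<exists>x. f x \<noteq> 0) \<and> bounded (fsupport f)"

end

theory Submission
  imports Defs
begin

text \<open>
  Let \<open>R\<close> be the right shift, \<open>A = 1 + R\<close> and \<open>v = e\<^sub>0/2\<close>. The function
  \<open>\<phi>(u) = |u|\<^sup>2/2 - \<rho>(u) + 16 \<rho>(A(u - v))\<close>, where \<open>\<rho>(z) = |z|\<^sup>2/(1 + |z|\<^sup>2)\<close>, stays within bounded
  distance of \<open>|u|\<^sup>2/2\<close> and has no critical point. Indeed a critical point solves
  \<open>\<lambda>u + A\<^sup>*A(u - v) = 0\<close> for some real \<open>\<lambda>\<close>. If \<open>\<lambda> \<ge> 0\<close> then \<open>|u| \<le> |v|\<close>, where the coefficient of \<open>u\<close>
  is negative, a contradiction. If \<open>\<lambda> < 0\<close> then \<open>|u| < 1\<close>, the factor 16 forces \<open>\<lambda> > -4\<close>, and \<open>-\<lambda>\<close> lies inside the continuous spectrum of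
  \<open>A\<^sup>*A\<close>: the coordinates of \<open>u - v\<close> solve a linear recurrence with a definite quadratic invariant and
  hence cannot tend to \<open>0\<close>.

  Now split \<open>\<ell>\<^sub>2\<close> as an orthogonal sum of infinitely many copies of itself and let \<open>\<Phi>\<close> be the sum of
  rescaled copies of \<open>\<phi>\<close> on the blocks. It is uniformly close to half the square of the norm and every
  block of its gradient is nonzero everywhere. The vectors with some vanishing block are dense and closed
  under scaling, so the cone of the gradients has empty interior. This persists for
  \<open>\<psi> = sqrt(2\<Phi> + 2\<kappa>)\<close> and for the bump \<open>max(0, 2 - \<psi>)\<^sup>2\<close>, whose gradients are multiples of those of \<open>\<Phi>\<close>.
\<close>

section \<open>Differentiability and Lipschitz estimates through gradients\<close>

text \<open>After division by \<open>norm (y - x)\<close> the remainder is still at most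
  \<open>C * norm (y - x)\<close>. This criterion serves the infinite sum over blocks, where
  remainder bounds can simply be added up, and the squared positive part.\<close>

lemma has_derivative_of_quadratic_remainder:
  fixes f :: "'a::real_inner \<Rightarrow> real"
  assumes "\<And>y. \<bar>f y - f x - inner g (y - x)\<bar> \<le> C * (norm (y - x))\<^sup>2"
  shows "(f has_derivative (\<lambda>h. inner g h)) (at x)"
proof (rule has_derivativeI_sandwich[where e = 1 and H = "\<lambda>y. C * norm (y - x)"])
  show "bounded_linear (\<lambda>h. inner g h)"
    by (rule bounded_linear_inner_right)
  show "norm (f y - f x - inner g (y - x)) / norm (y - x) \<le> C * norm (y - x)"
    if "y \<noteq> x" for y
    using assms[of y] that by (simp add: divide_le_eq power2_eq_square mult.assoc)
  show "((\<lambda>y. C * norm (y - x)) \<longlongrightarrow> 0) (at x)"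
    by (auto intro!: tendsto_eq_intros)
qed simp

text \<open>The mean value theorem on the segment from \<open>x\<close> to \<open>y\<close> turns
  the remainder into a difference of gradients paired with \<open>y - x\<close>.\<close>

lemma quadratic_remainder_of_lipschitz_gradient:
  fixes f :: "'a::real_inner \<Rightarrow> real"
  assumes der: "\<And>x. (f has_derivative (\<lambda>h. inner (G x) h)) (at x)"
    and lip: "M-lipschitz_on UNIV G"
  shows "\<bar>f y - f x - inner (G x) (y - x)\<bar> \<le> M * (norm (y - x))\<^sup>2"
proof -
  have "((\<lambda>t. f (x + t *\<^sub>R (y - x))) has_derivative
      (\<lambda>h. inner (G (x + t *\<^sub>R (y - x))) (h *\<^sub>R (y - x)))) (at t within {0..1})" for t :: real
    by (rule has_derivative_compose[OF _ der, where f = "\<lambda>t. x + t *\<^sub>R (y - x)"])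
       (auto intro!: derivative_eq_intros)
  then obtain t :: real where t: "t \<in> {0<..<1}"
    "f (x + 1 *\<^sub>R (y - x)) - f (x + 0 *\<^sub>R (y - x))
      = inner (G (x + t *\<^sub>R (y - x))) ((1 - 0) *\<^sub>R (y - x))"
    using mvt_simple[of 0 1 "\<lambda>t. f (x + t *\<^sub>R (y - x))"
        "\<lambda>t h. inner (G (x + t *\<^sub>R (y - x))) (h *\<^sub>R (y - x))"] by auto
  have "f y - f x - inner (G x) (y - x) = inner (G (x + t *\<^sub>R (y - x)) - G x) (y - x)"
    using t(2) by (simp add: inner_diff_left)
  also have "\<bar>\<dots>\<bar> \<le> norm (G (x + t *\<^sub>R (y - x)) - G x) * norm (y - x)"
    by (rule Cauchy_Schwarz_ineq2)
  also have "\<dots> \<le> (M * norm (y - x)) * norm (y - x)"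
  proof (rule mult_right_mono)
    have "norm (G (x + t *\<^sub>R (y - x)) - G x) \<le> M * norm (t *\<^sub>R (y - x))"
      using lipschitz_onD[OF lip, of "x + t *\<^sub>R (y - x)" x] by (simp add: dist_norm)
    also have "\<dots> \<le> M * norm (y - x)"
      using t(1) lipschitz_on_nonneg[OF lip]
      by (auto intro!: mult_left_mono simp: mult_left_le_one_le)
    finally show "norm (G (x + t *\<^sub>R (y - x)) - G x) \<le> M * norm (y - x)" .
  qed simp
  finally show ?thesis by (simp add: power2_eq_square mult.assoc)
qed

lemma lipschitz_on_of_bounded_gradient:
  fixes f :: "'a::real_inner \<Rightarrow> real"
  assumes "\<And>x. (f has_derivative (\<lambda>h. inner (G x) h)) (at x)"
    and "\<And>x. norm (G x) \<le> B"
  shows "B-lipschitz_on UNIV f"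
proof (rule lipschitz_onI)
  show B: "0 \<le> B"
    using assms(2)[of undefined] norm_ge_zero order_trans by blast
  have "onorm (inner (G x)) \<le> B" for x
  proof (rule onorm_bound)
    show "0 \<le> B" by (rule B)
    show "norm (inner (G x) h) \<le> B * norm h" for h
      using Cauchy_Schwarz_ineq2[of "G x" h] mult_right_mono[OF assms(2)[of x], of "norm h"]
      by simp
  qed
  then show "dist (f x) (f y) \<le> B * dist x y" for x y
    using differentiable_bound[of UNIV f "\<lambda>x h. inner (G x) h" B x y] assms(1)
    by (simp add: dist_norm)
qed

lemma lipschitz_on_scaleR_bounded:
  fixes c :: "'a::metric_space \<Rightarrow> real" and F :: "'a \<Rightarrow> 'b::real_normed_vector"
  assumes "K-lipschitz_on UNIV c" "\<And>x. \<bar>c x\<bar> \<le> C"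
    and "L-lipschitz_on UNIV F" "\<And>x. norm (F x) \<le> B"
  shows "(C * L + K * B)-lipschitz_on UNIV (\<lambda>x. c x *\<^sub>R F x)"
proof (rule lipschitz_onI)
  have nn: "0 \<le> K" "0 \<le> L" "0 \<le> C" "0 \<le> B"
    using lipschitz_on_nonneg[OF assms(1)] lipschitz_on_nonneg[OF assms(3)]
      assms(2)[of undefined] assms(4)[of undefined]
      norm_ge_zero[of "F undefined"] by linarith+
  then show "0 \<le> C * L + K * B" by simp
  show "dist (c x *\<^sub>R F x) (c y *\<^sub>R F y) \<le> (C * L + K * B) * dist x y" for x y
  proof -
    have "c x *\<^sub>R F x - c y *\<^sub>R F y = c x *\<^sub>R (F x - F y) + (c x - c y) *\<^sub>R F y"
      by (simp add: algebra_simps)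
    then have "norm (c x *\<^sub>R F x - c y *\<^sub>R F y)
        \<le> \<bar>c x\<bar> * norm (F x - F y) + \<bar>c x - c y\<bar> * norm (F y)"
      by (metis norm_triangle_ineq norm_scaleR)
    also have "\<dots> \<le> C * (L * dist x y) + (K * dist x y) * B"
      using lipschitz_onD[OF assms(1), of x y] lipschitz_onD[OF assms(3), of x y] nn
      by (intro add_mono mult_mono assms) (auto simp: dist_norm)
    finally show ?thesis by (simp add: dist_norm algebra_simps)
  qed
qed

section \<open>The bounded perturbation \<open>rho\<close>\<close>

text \<open>Equal to |z|^2 / (1 + |z|^2), written so that only an inverse has to be
  differentiated.\<close>

definition rho :: "'a::real_inner \<Rightarrow> real" where
  "rho z = 1 - inverse (1 + inner z z)"

definition grad_rho :: "'a::real_inner \<Rightarrow> 'a" where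
  "grad_rho z = (2 * (inverse (1 + inner z z))\<^sup>2) *\<^sub>R z"

lemma one_plus_inner_pos: "1 + inner z z > 0"
  by (simp add: add_pos_nonneg)

lemma rho_bounds: "0 \<le> rho z" "rho z \<le> 1"
  using one_plus_inner_pos[of z] by (auto simp: rho_def inverse_le_1_iff)

lemma has_derivative_rho: "(rho has_derivative (\<lambda>h. inner (grad_rho z) h)) (at z)"
  unfolding rho_def[abs_def] grad_rho_def using one_plus_inner_pos[of z]
  by (auto intro!: derivative_eq_intros simp: fun_eq_iff inner_commute power2_eq_square)

text \<open>The second derivative \<open>D z\<close> is bounded: with
  \<open>a = inverse (1 + inner z z)\<close> one has \<open>a \<le> 1\<close> and
  \<open>a * (norm z)\<^sup>2 \<le> 1\<close>, so its two terms contribute at most 2 and 8.\<close>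

lemma lipschitz_on_grad_rho: "10-lipschitz_on UNIV (grad_rho :: 'a::real_inner \<Rightarrow> 'a)"
proof (rule lipschitz_onI)
  define D :: "'a \<Rightarrow> 'a \<Rightarrow> 'a" where
    "D z h = (2 * (inverse (1 + inner z z))\<^sup>2) *\<^sub>R h
      - (8 * (inverse (1 + inner z z))^3 * inner z h) *\<^sub>R z" for z h
  have der: "(grad_rho has_derivative D z) (at z)" for z
    unfolding grad_rho_def[abs_def] D_def using one_plus_inner_pos[of z]
    by (auto intro!: derivative_eq_intros
        simp: fun_eq_iff inner_commute power2_eq_square power3_eq_cube algebra_simps)
  have "onorm (D z) \<le> 10" for z
  proof (rule onorm_bound)
    fix h
    define a where "a = inverse (1 + inner z z)"
    have a: "0 < a" "a \<le> 1" "a * (norm z)\<^sup>2 \<le> 1"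
      using one_plus_inner_pos[of z]
      by (auto simp: a_def inverse_le_1_iff power2_norm_eq_inner field_simps)
    have a2: "a\<^sup>2 \<le> 1" using a by (simp add: power_le_one)
    have "norm (D z h) \<le> 2 * a\<^sup>2 * norm h + 8 * a^3 * \<bar>inner z h\<bar> * norm z"
      unfolding D_def a_def[symmetric] using a(1)
      by (intro order_trans[OF norm_triangle_ineq4]) (simp add: abs_mult)
    also have "8 * a^3 * \<bar>inner z h\<bar> * norm z \<le> 8 * a^3 * (norm z * norm h) * norm z"
      using a(1) by (intro mult_left_mono mult_right_mono Cauchy_Schwarz_ineq2) auto
    also have "\<dots> = 8 * (a\<^sup>2 * (a * (norm z)\<^sup>2)) * norm h"
      by (simp add: power2_eq_square power3_eq_cube)
    also have "\<dots> \<le> 8 * (1 * 1) * norm h"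
      using a a2 by (intro mult_left_mono mult_right_mono mult_mono) auto
    also have "2 * a\<^sup>2 * norm h \<le> 2 * 1 * norm h"
      using a2 by (intro mult_left_mono mult_right_mono) auto
    finally show "norm (D z h) \<le> 10 * norm h" by simp
  qed simp
  then show "dist (grad_rho x) (grad_rho y) \<le> 10 * dist x y" for x y :: 'a
    using differentiable_bound[of UNIV grad_rho D 10 x y] der by (simp add: dist_norm)
qed simp

section \<open>Shifts on \<open>l2\<close> and the operator \<open>A\<close>\<close>

lift_definition rshift :: "l2 \<Rightarrow> l2" is "\<lambda>f n. case n of 0 \<Rightarrow> 0 | Suc m \<Rightarrow> f m"
  by (subst summable_Suc_iff[symmetric]) simp

lift_definition lshift :: "l2 \<Rightarrow> l2" is "\<lambda>f n. f (Suc n)"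
  by (subst (asm) summable_Suc_iff[symmetric]) simp

text \<open>A nonzero shift is essential: with 0 in its place the origin would be critical for
  \<open>phi\<close>. The size 1/2 is small enough for the sign argument in
  \<open>grad_phi_nonzero\<close>.\<close>

lift_definition half_e0 :: l2 is "\<lambda>n. if n = 0 then 1 / 2 else 0"
  by (rule summable_finite[of "{0}"]) auto

lemma l2_seq_simps:
  "l2_seq (x + y) n = l2_seq x n + l2_seq y n"
  "l2_seq (x - y) n = l2_seq x n - l2_seq y n"
  "l2_seq (c *\<^sub>R x) n = c * l2_seq x n"
  "l2_seq 0 n = 0"
  "l2_seq (lshift x) n = l2_seq x (Suc n)"
  "l2_seq (rshift x) 0 = 0"
  "l2_seq (rshift x) (Suc n) = l2_seq x n"
  "l2_seq half_e0 n = (if n = 0 then 1 / 2 else 0)"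
  by (transfer, simp)+

lemma l2_summable_inner: "summable (\<lambda>n. l2_seq x n * l2_seq y n)"
  by transfer (rule l2_summable_prod)

lemma inner_l2_eq: "inner x y = (\<Sum>n. l2_seq x n * l2_seq y n)"
  by (rule inner_l2.rep_eq)

lemma inner_rshift_left: "inner (rshift x) y = inner x (lshift y)"
proof -
  have "inner (rshift x) y = (\<Sum>n. l2_seq (rshift x) (Suc n) * l2_seq y (Suc n))"
    unfolding inner_l2_eq
    by (subst suminf_split_head[OF l2_summable_inner]) (simp add: l2_seq_simps)
  then show ?thesis by (simp add: inner_l2_eq l2_seq_simps)
qed

lemma lshift_rshift: "lshift (rshift x) = x"
  by transfer simp

lemma norm_rshift: "norm (rshift x) = norm x"
  by (simp add: norm_eq_sqrt_inner inner_rshift_left lshift_rshift)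

lemma norm_half_e0: "norm half_e0 = 1 / 2"
proof -
  have "inner half_e0 half_e0 = (\<Sum>n\<in>{0}. l2_seq half_e0 n * l2_seq half_e0 n)"
    unfolding inner_l2_eq by (rule suminf_finite) (auto simp: l2_seq_simps)
  then have "inner half_e0 half_e0 = (1/2)\<^sup>2" by (simp add: l2_seq_simps power2_eq_square)
  then show ?thesis
    by (metis norm_eq_sqrt_inner real_sqrt_abs abs_of_nonneg zero_le_divide_1_iff zero_le_numeral)
qed

lemma l2_seq_tendsto_0: "l2_seq x \<longlonglongrightarrow> 0"
proof -
  have "(\<lambda>n. (l2_seq x n)\<^sup>2) \<longlonglongrightarrow> 0"
    using summable_LIMSEQ_zero[OF l2_summable_inner[of x x]] by (simp add: power2_eq_square)
  then have "(\<lambda>n. sqrt ((l2_seq x n)\<^sup>2)) \<longlonglongrightarrow> sqrt 0"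
    by (rule tendsto_real_sqrt)
  then show ?thesis by (simp add: tendsto_rabs_zero_iff)
qed

text \<open>Since \<open>lshift\<close> inverts \<open>rshift\<close> on the left,
  \<open>A_adj (A x)\<close> equals \<open>2 *\<^sub>R x + rshift x + lshift x\<close>, a
  tridiagonal Toeplitz operator with spectrum [0, 4].\<close>

definition A :: "l2 \<Rightarrow> l2" where "A x = x + rshift x"
definition A_adj :: "l2 \<Rightarrow> l2" where "A_adj x = x + lshift x"

lemma inner_A_adj: "inner (A_adj x) y = inner x (A y)"
  by (metis A_adj_def A_def inner_add_left inner_add_right inner_commute inner_rshift_left)

lemma norm_A_le: "norm (A x) \<le> norm x * 2"
  unfolding A_def using norm_triangle_ineq[of x "rshift x"] by (simp add: norm_rshift)

lemma bounded_linear_A: "bounded_linear A"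
proof (rule bounded_linear_intro)
  show "A (x + y) = A x + A y" for x y
    unfolding A_def by transfer (auto simp: fun_eq_iff split: nat.split)
  show "A (r *\<^sub>R x) = r *\<^sub>R A x" for r x
    unfolding A_def by transfer (auto simp: fun_eq_iff algebra_simps split: nat.split)
qed (rule norm_A_le)

lemma A_diff: "A (x - y) = A x - A y"
  by (rule linear_diff[OF bounded_linear.linear[OF bounded_linear_A]])

lemma A_adj_diff: "A_adj (x - y) = A_adj x - A_adj y"
  unfolding A_adj_def by transfer (auto simp: fun_eq_iff)

lemma A_adj_scaleR: "A_adj (r *\<^sub>R x) = r *\<^sub>R A_adj x"
  unfolding A_adj_def by transfer (auto simp: fun_eq_iff algebra_simps)

lemma norm_A_adj_le: "norm (A_adj x) \<le> 2 * norm x"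
proof (cases "A_adj x = 0")
  case False
  have "norm (A_adj x) * norm (A_adj x) = inner x (A (A_adj x))"
    by (simp add: inner_A_adj[symmetric] power2_norm_eq_inner[symmetric] power2_eq_square)
  also have "\<dots> \<le> norm x * (norm (A_adj x) * 2)"
    by (meson norm_cauchy_schwarz norm_A_le mult_left_mono norm_ge_zero order_trans)
  finally show ?thesis using False by simp
qed simp


section \<open>The function \<open>phi\<close> and the absence of critical points\<close>

text \<open>For these \<open>lam\<close> the characteristic roots are conjugate on the unit circle,
  so only the zero solution of the recurrence decays; the nonzero right side of \<open>head\<close>
  excludes that one.\<close>

lemma tridiagonal_recurrence_no_solution:
  fixes w :: "nat \<Rightarrow> real"
  assumes lam: "-4 < lam" "lam < 0" and lim: "w \<longlonglongrightarrow> 0"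
    and head: "(lam + 2) * w 0 + w 1 = - lam / 2"
    and rec: "\<And>n. (lam + 2) * w (Suc n) + w n + w (Suc (Suc n)) = 0"
  shows False
proof -
  \<comment> \<open>The recurrence conserves this form, which is positive definite since \<open>\<bar>lam + 2\<bar> < 2\<close>.\<close>
  define E where "E n = (w n)\<^sup>2 + (w (Suc n))\<^sup>2 + (lam + 2) * w n * w (Suc n)" for n
  have step: "E (Suc n) = E n" for n
  proof -
    have "w (Suc (Suc n)) = - (lam + 2) * w (Suc n) - w n"
      using rec[of n] by (simp add: algebra_simps)
    then show ?thesis
      unfolding E_def by (simp only:) (simp add: algebra_simps power2_eq_square)
  qed
  have E: "E = (\<lambda>n. E 0)"
  proof
    show "E n = E 0" for n by (induction n) (simp_all add: step)
  qed
  have limS: "(\<lambda>n. w (Suc n)) \<longlonglongrightarrow> 0"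
    using lim by (rule LIMSEQ_Suc)
  have "E \<longlonglongrightarrow> 0\<^sup>2 + 0\<^sup>2 + (lam + 2) * 0 * 0"
    unfolding E_def by (intro tendsto_intros lim limS)
  then have "E 0 = 0"
    by (subst (asm) E) (simp add: LIMSEQ_const_iff)
  moreover have "E 0 = (w 1 + (lam + 2) / 2 * w 0)\<^sup>2 + (1 - ((lam + 2) / 2)\<^sup>2) * (w 0)\<^sup>2"
    unfolding E_def by (simp add: power2_eq_square algebra_simps)
  moreover have pos: "1 - ((lam + 2) / 2)\<^sup>2 > 0"
    using lam abs_square_less_1[of "(lam + 2) / 2"] by (auto simp: abs_less_iff)
  ultimately have "(w 1 + (lam + 2) / 2 * w 0)\<^sup>2 = 0" "(1 - ((lam + 2) / 2)\<^sup>2) * (w 0)\<^sup>2 = 0"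
    by (smt (verit) mult_nonneg_nonneg zero_le_power2)+
  then have "w 0 = 0" "w 1 = 0" using pos by auto
  with head lam show False by simp
qed

definition phi :: "l2 \<Rightarrow> real" where
  "phi u = inner u u / 2 - rho u + 16 * rho (A (u - half_e0))"

definition grad_phi :: "l2 \<Rightarrow> l2" where
  "grad_phi u = u - grad_rho u + 16 *\<^sub>R A_adj (grad_rho (A (u - half_e0)))"

lemma phi_bound: "\<bar>phi u - inner u u / 2\<bar> \<le> 16"
  using rho_bounds[of u] rho_bounds[of "A (u - half_e0)"] by (auto simp: phi_def)

lemma has_derivative_phi: "(phi has_derivative (\<lambda>h. inner (grad_phi u) h)) (at u)"
proof -
  have "((\<lambda>x. A (x - half_e0)) has_derivative A) (at u)"
    by (rule bounded_linear.has_derivative[OF bounded_linear_A]) (auto intro!: derivative_eq_intros)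
  from has_derivative_compose[OF this has_derivative_rho]
  have "((\<lambda>x. rho (A (x - half_e0))) has_derivative
      (\<lambda>h. inner (grad_rho (A (u - half_e0))) (A h))) (at u)" .
  moreover have "((\<lambda>x. inner x x / 2) has_derivative (\<lambda>h. inner u h)) (at u)"
    by (auto intro!: derivative_eq_intros simp: inner_commute)
  ultimately have "(phi has_derivative (\<lambda>h. inner u h - inner (grad_rho u) h
      + 16 * inner (grad_rho (A (u - half_e0))) (A h))) (at u)"
    unfolding phi_def[abs_def]
    by (intro has_derivative_add has_derivative_diff has_derivative_rho has_derivative_mult_right)
  moreover have "inner u h - inner (grad_rho u) h
      + 16 * inner (grad_rho (A (u - half_e0))) (A h) = inner (grad_phi u) h" for h
    by (simp add: grad_phi_def inner_diff_left inner_add_left inner_A_adj)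
  ultimately show ?thesis by simp
qed

text \<open>The constant is 1 + 10 + 16 * 2 * 10 * 2: the identity, \<open>grad_rho\<close>, and 16
  times the bounds for \<open>A_adj\<close>, \<open>grad_rho\<close> and \<open>A\<close>.\<close>

lemma lipschitz_on_grad_phi: "651-lipschitz_on UNIV grad_phi"
proof (rule lipschitz_onI)
  fix x y
  let ?a = "A (x - half_e0)" and ?b = "A (y - half_e0)"
  have "norm (?a - ?b) \<le> norm (x - y) * 2"
    using norm_A_le[of "x - y"] by (simp add: A_diff)
  moreover have "norm (grad_rho ?a - grad_rho ?b) \<le> 10 * norm (?a - ?b)"
    "norm (grad_rho x - grad_rho y) \<le> 10 * norm (x - y)"
    using lipschitz_onD[OF lipschitz_on_grad_rho] by (auto simp: dist_norm)
  moreover have "norm (A_adj (grad_rho ?a) - A_adj (grad_rho ?b)) \<le> 2 * norm (grad_rho ?a - grad_rho ?b)"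
    using norm_A_adj_le by (simp flip: A_adj_diff)
  moreover have "norm (grad_phi x - grad_phi y) \<le> norm (x - y) + norm (grad_rho x - grad_rho y)
      + 16 * norm (A_adj (grad_rho ?a) - A_adj (grad_rho ?b))"
  proof -
    have "grad_phi x - grad_phi y = (x - y) - (grad_rho x - grad_rho y)
        + 16 *\<^sub>R (A_adj (grad_rho ?a) - A_adj (grad_rho ?b))"
      by (simp add: grad_phi_def algebra_simps)
    then show ?thesis
      by (metis (no_types, opaque_lifting) norm_triangle_mono norm_triangle_ineq4 order_refl
          norm_scaleR abs_numeral)
  qed
  ultimately show "dist (grad_phi x) (grad_phi y) \<le> 651 * dist x y"
    by (simp add: dist_norm)
qed simp

lemma grad_phi_nonzero: "grad_phi u \<noteq> 0"
proof
  assume crit: "grad_phi u = 0"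
  define w where "w = u - half_e0"
  \<comment> \<open>Each \<open>grad_rho z\<close> is a scalar multiple of \<open>z\<close>, so with
    these scalars frozen the critical point equation becomes linear. The 32 is 16 times the 2 in
    \<open>grad_rho\<close>.\<close>
  define c where "c = 1 - 2 * (inverse (1 + inner u u))\<^sup>2"
  define k where "k = 32 * (inverse (1 + inner (A w) (A w)))\<^sup>2"
  define lam where "lam = c / k"
  have k: "k > 0" using one_plus_inner_pos[of "A w"] by (simp add: k_def)
  have "c *\<^sub>R u + k *\<^sub>R A_adj (A w) = 0"
    using crit by (simp add: grad_phi_def grad_rho_def A_adj_scaleR w_def c_def k_def algebra_simps)
  then have "(1 / k) *\<^sub>R (c *\<^sub>R u + k *\<^sub>R A_adj (A w)) = 0" by simp
  then have eq: "lam *\<^sub>R u + A_adj (A w) = 0"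
    using k by (simp add: scaleR_add_right lam_def)
  have small: "norm u \<le> 1 / 2" if "lam \<ge> 0"
  proof (cases "lam = 0")
    \<comment> \<open>Here \<open>A w = 0\<close>, and \<open>A\<close> is injective by induction on
      the coordinates, so \<open>u = half_e0\<close>.\<close>
    case True
    then have "inner (A w) (A w) = 0"
      using eq inner_A_adj[of "A w" w] by simp
    then have "A w = 0" by simp
    then have "w = - rshift w" by (simp add: A_def eq_neg_iff_add_eq_0)
    then have eqn: "l2_seq w n = - l2_seq (rshift w) n" for n
      by (metis l2_seq_simps(3) mult_minus1 scaleR_minus1_left)
    have "l2_seq w n = 0" for n
      by (induction n) (use eqn in \<open>simp_all add: l2_seq_simps\<close>)
    then have "w = 0" by transfer auto
    then show ?thesis by (simp add: w_def norm_half_e0)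
  next
    case False
    then have lam: "lam > 0" using that by simp
    \<comment> \<open>Pairing with \<open>w\<close> gives \<open>inner u w \<le> 0\<close>, that is,
      |u|^2 is at most \<open>inner u half_e0\<close>.\<close>
    have "lam * inner u w + inner (A w) (A w) = 0"
      using arg_cong[OF eq, of "\<lambda>z. inner z w"] by (simp add: inner_add_left inner_A_adj)
    then have "lam * inner u w \<le> 0" by (smt (verit) inner_ge_zero)
    then have "inner u w \<le> 0" using lam by (simp add: mult_le_0_iff)
    then have "norm u * norm u \<le> inner u half_e0"
      by (simp add: w_def inner_diff_right power2_norm_eq_inner[symmetric] power2_eq_square)
    also have "\<dots> \<le> norm u * (1 / 2)"
      using norm_cauchy_schwarz[of u half_e0] by (simp add: norm_half_e0)
    finally show ?thesis by (cases "u = 0") auto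
  qed
  have neg: "lam < 0"
  proof (rule ccontr)
    assume "\<not> lam < 0"
    then have "lam \<ge> 0" by simp
    then have "norm u \<le> 1 / 2" by (rule small)
    have "c \<ge> 0"
      using \<open>lam \<ge> 0\<close> k by (simp add: lam_def zero_le_divide_iff)
    \<comment> \<open>This bound yields \<open>c \<le> 1 - 2 * (4/5)\<^sup>2\<close>, which is
      negative.\<close>
    have "inner u u \<le> (1/2)\<^sup>2"
      unfolding power2_norm_eq_inner[symmetric] using \<open>norm u \<le> 1 / 2\<close> by (rule power_mono) simp
    then have "inverse (1 + inner u u) \<ge> inverse (5 / 4)"
      using one_plus_inner_pos[of u] by (intro le_imp_inverse_le) (auto simp: power2_eq_square)
    then have "(inverse (1 + inner u u))\<^sup>2 \<ge> (inverse (5 / 4))\<^sup>2"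
      by (intro power_mono) auto
    then show False using \<open>c \<ge> 0\<close> by (simp add: c_def power2_eq_square)
  qed
  have "c < 0" using neg k by (simp add: lam_def divide_less_0_iff)
  have "inner u u < 1"
  proof (rule ccontr)
    assume "\<not> ?thesis"
    then have "inverse (1 + inner u u) \<le> inverse 2"
      by (intro le_imp_inverse_le) auto
    then have "(inverse (1 + inner u u))\<^sup>2 \<le> (inverse 2)\<^sup>2"
      using one_plus_inner_pos[of u] by (intro power_mono) auto
    then show False using \<open>c < 0\<close> by (simp add: c_def power2_eq_square)
  qed
  then have "norm u < 1" by (simp add: norm_eq_sqrt_inner)
  \<comment> \<open>From |w| < 3/2 one gets \<open>k \<ge> 32 / 100\<close>; with
    \<open>c \<ge> -1\<close> this gives \<open>lam \<ge> -100 / 32\<close>, above -4. The weight 16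
    in \<open>phi\<close> is large enough for this.\<close>
  then have "norm (A w) \<le> 3"
    using norm_triangle_ineq4[of u half_e0] norm_A_le[of w] by (simp add: w_def norm_half_e0)
  then have "inner (A w) (A w) \<le> 3\<^sup>2"
    by (metis norm_ge_zero power2_norm_eq_inner power_mono)
  then have "inverse (1 + inner (A w) (A w)) \<ge> inverse 10"
    using one_plus_inner_pos[of "A w"] by (intro le_imp_inverse_le) auto
  then have "(inverse (1 + inner (A w) (A w)))\<^sup>2 \<ge> (inverse 10)\<^sup>2"
    by (intro power_mono) auto
  then have "k \<ge> 32 / 100" by (simp add: k_def power2_eq_square)
  moreover have "c \<ge> -1"
    using one_plus_inner_pos[of u] by (simp add: c_def power_le_one inverse_le_1_iff)
  ultimately have lam4: "-4 < lam"
    using k by (simp add: lam_def less_divide_eq)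
  \<comment> \<open>Passing from \<open>u\<close> to \<open>w\<close> affects only coordinate 0,
    which is where the term \<open>- lam / 2\<close> arises.\<close>
  have coord: "lam * l2_seq u n + l2_seq (A_adj (A w)) n = 0" for n
    using arg_cong[OF eq, of "\<lambda>z. l2_seq z n"] by (simp add: l2_seq_simps)
  have u: "l2_seq u n = l2_seq w n + l2_seq half_e0 n" for n
    by (simp add: w_def l2_seq_simps)
  show False
  proof (rule tridiagonal_recurrence_no_solution[OF lam4 neg l2_seq_tendsto_0])
    show "(lam + 2) * l2_seq w 0 + l2_seq w 1 = - lam / 2"
      using coord[of 0] unfolding u A_adj_def A_def by (simp add: l2_seq_simps algebra_simps)
    show "(lam + 2) * l2_seq w (Suc n) + l2_seq w n + l2_seq w (Suc (Suc n)) = 0" for n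
      using coord[of "Suc n"] unfolding u A_adj_def A_def by (simp add: l2_seq_simps algebra_simps)
  qed
qed


section \<open>Decomposition of \<open>l2\<close> into infinitely many blocks\<close>

text \<open>The pairing bijection splits the indices into infinitely many infinite rows. Square
  summability of a row is obtained through unordered sums, which allow restriction and
  reindexing.\<close>

lift_definition block :: "nat \<Rightarrow> l2 \<Rightarrow> l2" is "\<lambda>n f k. f (prod_encode (n, k))"
proof -
  fix n :: nat and f :: "nat \<Rightarrow> real"
  assume "summable (\<lambda>i. (f i)\<^sup>2)"
  then have "(\<lambda>i. (f i)\<^sup>2) summable_on UNIV"
    by (subst summable_on_UNIV_nonneg_real_iff) auto
  then have "(\<lambda>i. (f i)\<^sup>2) summable_on range (\<lambda>k. prod_encode (n, k))"
    by (rule summable_on_subset_banach) simp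
  moreover have "inj (\<lambda>k. prod_encode (n, k))"
    by (simp add: inj_on_def)
  ultimately have "((\<lambda>i. (f i)\<^sup>2) \<circ> (\<lambda>k. prod_encode (n, k))) summable_on UNIV"
    using summable_on_reindex by blast
  then have "summable ((\<lambda>i. (f i)\<^sup>2) \<circ> (\<lambda>k. prod_encode (n, k)))"
    by (rule summable_on_imp_summable)
  then show "summable (\<lambda>k. (f (prod_encode (n, k)))\<^sup>2)"
    by (simp only: o_def)
qed

lemma l2_seq_block: "l2_seq (block n x) k = l2_seq x (prod_encode (n, k))"
  by (simp add: block.rep_eq)

text \<open>Absolute convergence makes the inner product an unordered sum, so that it may be
  regrouped by blocks.\<close>

lemma l2_has_sum_inner: "((\<lambda>i. l2_seq x i * l2_seq y i) has_sum inner x y) UNIV"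
proof (rule norm_summable_imp_has_sum)
  have "summable (\<lambda>i. \<bar>l2_seq x i\<bar> * \<bar>l2_seq y i\<bar>)"
    using l2_seq[of x] l2_seq[of y] by (intro l2_summable_prod) auto
  then show "summable (\<lambda>i. norm (l2_seq x i * l2_seq y i))"
    by (simp add: abs_mult)
  show "(\<lambda>i. l2_seq x i * l2_seq y i) sums inner x y"
    unfolding inner_l2_eq by (rule summable_sums[OF l2_summable_inner])
qed

lemma block_inner_sums: "(\<lambda>n. inner (block n x) (block n y)) sums inner x y"
proof (rule has_sum_imp_sums)
  have "((\<lambda>p. l2_seq x (prod_encode p) * l2_seq y (prod_encode p)) has_sum inner x y)
      (Sigma UNIV (\<lambda>_. UNIV))"
    using has_sum_reindex_bij_betw[OF bij_prod_encode, of "\<lambda>i. l2_seq x i * l2_seq y i"]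
      l2_has_sum_inner[of x y] by simp
  then show "((\<lambda>n. inner (block n x) (block n y)) has_sum inner x y) UNIV"
  proof (rule has_sum_SigmaD)
    show "((\<lambda>k. l2_seq x (prod_encode (n, k)) * l2_seq y (prod_encode (n, k)))
        has_sum inner (block n x) (block n y)) UNIV" for n
      using l2_has_sum_inner[of "block n x" "block n y"] by (simp only: l2_seq_block)
  qed
qed

lemma block_norm_sums: "(\<lambda>n. (norm (block n x))\<^sup>2) sums (norm x)\<^sup>2"
  using block_inner_sums[of x x] by (simp add: power2_norm_eq_inner)

lemma block_simps:
  "block n (x - y) = block n x - block n y"
  "block n (c *\<^sub>R x) = c *\<^sub>R block n x"
  "block n 0 = 0"
  by (transfer, simp)+

text \<open>Surjectivity of the decomposition: the double family of coordinates is square summable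
  and is read back along \<open>prod_decode\<close>.\<close>

lemma exists_l2_of_blocks:
  assumes "summable (\<lambda>n. (norm (y n))\<^sup>2)"
  shows "\<exists>z. \<forall>n. block n z = y n"
proof -
  define f where "f p = l2_seq (y (fst p)) (snd p)" for p
  have "(\<lambda>p. (f p)\<^sup>2) summable_on (Sigma UNIV (\<lambda>_. UNIV))"
  proof (rule summable_on_SigmaI)
    show "((\<lambda>k. (f (n, k))\<^sup>2) has_sum (norm (y n))\<^sup>2) UNIV" for n
      using l2_has_sum_inner[of "y n" "y n"]
      by (simp add: f_def power2_eq_square[of "l2_seq _ _"] power2_norm_eq_inner)
    show "(\<lambda>n. (norm (y n))\<^sup>2) summable_on UNIV"
      using assms by (subst summable_on_UNIV_nonneg_real_iff) auto
  qed simp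
  then have "(\<lambda>i. (f (prod_decode i))\<^sup>2) summable_on UNIV"
    using summable_on_reindex_bij_betw[OF bij_prod_decode, of "\<lambda>p. (f p)\<^sup>2"] by simp
  then have s: "summable (\<lambda>i. (f (prod_decode i))\<^sup>2)"
    by (rule summable_on_imp_summable)
  have "l2_seq (block n (Abs_l2 (\<lambda>i. f (prod_decode i)))) = l2_seq (y n)" for n
    using s by (simp add: fun_eq_iff l2_seq_block Abs_l2_inverse f_def)
  then show ?thesis by (metis l2_seq_inject)
qed

text \<open>Block norms tend to 0, so deleting one far block moves a vector arbitrarily little.
  Every ball thus contains a nonzero vector with a vanishing block.\<close>

lemma empty_interior_of_blocks_nonzero:
  assumes "\<And>z. z \<in> S \<Longrightarrow> z = 0 \<or> (\<forall>n. block n z \<noteq> 0)"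
  shows "interior S = {}"
proof (rule ccontr)
  assume "interior S \<noteq> {}"
  then obtain y0 e0 where "e0 > 0" and ball0: "ball y0 e0 \<subseteq> S"
    by (auto simp: mem_interior)
  have half: "half_e0 \<noteq> 0" using norm_half_e0 by auto
  \<comment> \<open>A nonzero centre is needed so that the vector after deletion can be kept away
    from 0.\<close>
  obtain y e where y: "y \<noteq> 0" "e > 0" and ball: "ball y e \<subseteq> S"
  proof (cases "y0 = 0")
    case False
    then show ?thesis using that \<open>e0 > 0\<close> ball0 by blast
  next
    case True
    let ?y = "(e0 / 2) *\<^sub>R half_e0"
    have "dist y0 ?y < e0 / 2"
      using True \<open>e0 > 0\<close> by (simp add: dist_norm norm_half_e0)
    have "ball ?y (e0 / 2) \<subseteq> ball y0 e0"
    proof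
      fix z assume "z \<in> ball ?y (e0 / 2)"
      then show "z \<in> ball y0 e0"
        using \<open>dist y0 ?y < e0 / 2\<close> dist_triangle[of y0 z ?y] unfolding mem_ball by linarith
    qed
    then show ?thesis using that[of ?y "e0 / 2"] \<open>e0 > 0\<close> ball0 half by auto
  qed
  have "(\<lambda>n. (norm (block n y))\<^sup>2) \<longlonglongrightarrow> 0"
    by (rule summable_LIMSEQ_zero[OF sums_summable[OF block_norm_sums]])
  \<comment> \<open>Distance below \<open>e\<close> keeps \<open>z\<close> in the ball; distance
    below \<open>norm y\<close> keeps it nonzero.\<close>
  moreover have "0 < (min e (norm y))\<^sup>2" using y by (intro zero_less_power) simp
  ultimately have "eventually (\<lambda>n. (norm (block n y))\<^sup>2 < (min e (norm y))\<^sup>2) sequentially"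
    by (rule order_tendstoD)
  then obtain n where n: "(norm (block n y))\<^sup>2 < (min e (norm y))\<^sup>2"
    by (auto simp: eventually_sequentially)
  have "summable (\<lambda>m. (norm (if m = n then 0 else block m y))\<^sup>2)"
    by (rule summable_comparison_test'[OF sums_summable[OF block_norm_sums[of y]], of 0]) auto
  then obtain z where z: "block m z = (if m = n then 0 else block m y)" for m
    using exists_l2_of_blocks[of "\<lambda>m. if m = n then 0 else block m y"] by blast
  have "(\<lambda>m. (norm (block m (y - z)))\<^sup>2) sums (norm (block n y))\<^sup>2"
    using sums_single[of n "\<lambda>m. (norm (block m y))\<^sup>2"]
    by (rule sums_cong[THEN iffD1, rotated]) (auto simp: block_simps z)
  then have norm_eq: "(norm (y - z))\<^sup>2 = (norm (block n y))\<^sup>2"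
    using block_norm_sums sums_unique2 by blast
  have close: "norm (y - z) < min e (norm y)"
  proof (rule power2_less_imp_less)
    show "(norm (y - z))\<^sup>2 < (min e (norm y))\<^sup>2"
      using n by (simp only: norm_eq)
    show "0 \<le> min e (norm y)" using y by simp
  qed
  then have "z \<in> S" using ball by (auto simp: dist_norm)
  moreover have "z \<noteq> 0" using close by auto
  ultimately show False using assms[of z] z[of n] by auto
qed


section \<open>Gluing rescaled copies of \<open>phi\<close> along the blocks\<close>

text \<open>The scaling \<open>(e n)\<^sup>2 * phi (u /\<^sub>R e n)\<close> preserves the
  gradient's Lipschitz constant 651 but shrinks the distance to |u|^2 / 2 to
  \<open>16 * (e n)\<^sup>2\<close>, which can be made summable.\<close>

lemma exists_smooth_approx_half_square:
  assumes "\<kappa> > 0"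
  obtains \<Phi> :: "l2 \<Rightarrow> real" and g M where
    "\<And>x. (\<Phi> has_derivative (\<lambda>h. inner (g x) h)) (at x)" "M-lipschitz_on UNIV g"
    "\<And>x. \<bar>2 * \<Phi> x - (norm x)\<^sup>2\<bar> \<le> \<kappa>" "\<And>x n. block n (g x) \<noteq> 0"
proof -
  \<comment> \<open>Normalised so that the errors \<open>16 * s n\<close> add up to
    \<open>\<kappa> / 2\<close>.\<close>
  define s where "s n = \<kappa> / 64 * (1 / 2) ^ n" for n :: nat
  have s_pos: "s n > 0" for n using assms by (simp add: s_def)
  have "(\<lambda>n. \<kappa> / 64 * (1 / 2) ^ n) sums (\<kappa> / 64 * (1 / (1 - 1 / 2)))"
    by (intro sums_mult geometric_sums) simp
  then have s_sums: "s sums (\<kappa> / 32)" by (simp add: s_def[abs_def])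
  define e where "e n = sqrt (s n)" for n
  have e: "e n > 0" "(e n)\<^sup>2 = s n" for n using s_pos[of n] by (auto simp: e_def)
  define F where "F n u = (e n)\<^sup>2 * phi (u /\<^sub>R e n)" for n u
  define H where "H n u = e n *\<^sub>R grad_phi (u /\<^sub>R e n)" for n u
  have F_close: "\<bar>F n u - (norm u)\<^sup>2 / 2\<bar> \<le> 16 * s n" for n u
  proof -
    have "F n u - (norm u)\<^sup>2 / 2
        = (e n)\<^sup>2 * (phi (u /\<^sub>R e n) - inner (u /\<^sub>R e n) (u /\<^sub>R e n) / 2)"
      using e(1)[of n] unfolding power2_norm_eq_inner
      by (simp add: F_def field_simps power2_eq_square)
    also have "\<bar>\<dots>\<bar> \<le> (e n)\<^sup>2 * 16"
      unfolding abs_mult using phi_bound[of "u /\<^sub>R e n"] by (intro mult_mono) auto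
    finally show ?thesis by (simp add: e)
  qed
  have F_rem: "\<bar>F n v - F n u - inner (H n u) (v - u)\<bar> \<le> 651 * (norm (v - u))\<^sup>2" for n u v
  proof -
    let ?u = "u /\<^sub>R e n" and ?v = "v /\<^sub>R e n"
    have d: "?v - ?u = (v - u) /\<^sub>R e n" by (simp add: scaleR_diff_right)
    have "F n v - F n u - inner (H n u) (v - u)
        = (e n)\<^sup>2 * (phi ?v - phi ?u - inner (grad_phi ?u) (?v - ?u))"
      unfolding d inner_scaleR_right using e(1)[of n]
      by (simp add: F_def H_def right_diff_distrib power2_eq_square)
    also have "\<bar>\<dots>\<bar> \<le> (e n)\<^sup>2 * (651 * (norm (?v - ?u))\<^sup>2)"
      unfolding abs_mult
      using quadratic_remainder_of_lipschitz_gradient[OF has_derivative_phi lipschitz_on_grad_phi]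
      by (intro mult_mono) auto
    also have "\<dots> = 651 * (norm (v - u))\<^sup>2"
      unfolding d norm_scaleR using e(1)[of n] by (simp add: power_mult_distrib power_inverse)
    finally show ?thesis .
  qed
  have H_lip: "norm (H n v - H n u) \<le> 651 * norm (v - u)" for n u v
  proof -
    have "norm (H n v - H n u) = e n * norm (grad_phi (v /\<^sub>R e n) - grad_phi (u /\<^sub>R e n))"
      using e(1)[of n] by (simp add: H_def scaleR_diff_right[symmetric])
    also have "\<dots> \<le> e n * (651 * norm ((v - u) /\<^sub>R e n))"
      using lipschitz_onD[OF lipschitz_on_grad_phi, of "v /\<^sub>R e n" "u /\<^sub>R e n"] e(1)[of n]
      by (intro mult_left_mono) (auto simp: dist_norm scaleR_diff_right)
    also have "norm ((v - u) /\<^sub>R e n) = norm (v - u) / e n"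
      using e(1)[of n] by (simp add: divide_inverse_commute)
    also have "e n * (651 * (norm (v - u) / e n)) = 651 * norm (v - u)"
      using e(1)[of n] by (metis less_irrefl mult.left_commute nonzero_mult_div_cancel_left times_divide_eq_right)
    finally show ?thesis .
  qed
  \<comment> \<open>The gradients at 0 do not vanish; their square summability, together with
    \<open>H_lip\<close>, makes the blocks \<open>H n (block n x)\<close> square summable.\<close>
  have H_0: "(norm (H n 0))\<^sup>2 = s n * (norm (grad_phi 0))\<^sup>2" for n
    by (simp add: H_def e power_mult_distrib)
  have H_nz: "H n u \<noteq> 0" for n u
    using grad_phi_nonzero e(1)[of n] by (simp add: H_def)
  have "\<exists>z. \<forall>n. block n z = H n (block n x)" for x
  proof (rule exists_l2_of_blocks)
    show "summable (\<lambda>n. (norm (H n (block n x)))\<^sup>2)"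
    proof (rule summable_comparison_test'[where N = 0])
      show "summable (\<lambda>n. 2 * (651\<^sup>2 * (norm (block n x))\<^sup>2) + 2 * (s n * (norm (grad_phi 0))\<^sup>2))"
        using block_norm_sums[of x] s_sums
        by (intro summable_add summable_mult summable_mult2) (auto dest: sums_summable)
      fix n
      have "norm (H n (block n x)) \<le> 651 * norm (block n x) + norm (H n 0)"
        using H_lip[of n "block n x" 0] norm_triangle_sub[of "H n (block n x)" "H n 0"] by simp
      then have "(norm (H n (block n x)))\<^sup>2 \<le> (651 * norm (block n x) + norm (H n 0))\<^sup>2"
        by (intro power_mono) auto
      also have "\<dots> \<le> 2 * (651 * norm (block n x))\<^sup>2 + 2 * (norm (H n 0))\<^sup>2"
        using sum_squares_bound[of "651 * norm (block n x)" "norm (H n 0)"]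
        by (simp add: power2_sum)
      finally show "norm ((norm (H n (block n x)))\<^sup>2)
          \<le> 2 * (651\<^sup>2 * (norm (block n x))\<^sup>2) + 2 * (s n * (norm (grad_phi 0))\<^sup>2)"
        by (simp only: H_0 power_mult_distrib real_norm_def abs_power2)
    qed
  qed
  then obtain g where g: "\<And>x n. block n (g x) = H n (block n x)" by metis
  define \<Phi> where "\<Phi> x = (\<Sum>n. F n (block n x))" for x
  \<comment> \<open>Convergence of the series for \<open>\<Phi> x\<close> comes from splitting off
    the convergent series of \<open>(norm (block n x))\<^sup>2 / 2\<close>.\<close>
  have err_summable: "summable (\<lambda>n. F n (block n x) - (norm (block n x))\<^sup>2 / 2)" for x
    by (rule summable_comparison_test'[of "\<lambda>n. 16 * s n" 0])
      (use F_close sums_summable[OF s_sums] in auto)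
  have half_sums: "(\<lambda>n. (norm (block n x))\<^sup>2 / 2) sums ((norm x)\<^sup>2 / 2)" for x
    by (rule sums_divide[OF block_norm_sums])
  have F_sums: "(\<lambda>n. F n (block n x)) sums \<Phi> x" for x
    using summable_add[OF err_summable[of x] sums_summable[OF half_sums[of x]]]
    by (simp add: \<Phi>_def summable_sums)
  show thesis
  proof (rule that)
    show "(\<Phi> has_derivative (\<lambda>h. inner (g x) h)) (at x)" for x
    proof (rule has_derivative_of_quadratic_remainder)
      fix y
      \<comment> \<open>Summing the blockwise remainder bounds, all with the same constant, replaces
        a theorem on termwise differentiation.\<close>
      have sums: "(\<lambda>n. F n (block n y) - F n (block n x)
            - inner (H n (block n x)) (block n y - block n x))
          sums (\<Phi> y - \<Phi> x - inner (g x) (y - x))"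
        using block_inner_sums[of "g x" "y - x"]
        by (intro sums_diff F_sums) (simp add: g block_simps)
      have bound: "(\<lambda>n. 651 * (norm (block n y - block n x))\<^sup>2) sums (651 * (norm (y - x))\<^sup>2)"
        using sums_mult[OF block_norm_sums[of "y - x"], of 651] by (simp add: block_simps)
      show "\<bar>\<Phi> y - \<Phi> x - inner (g x) (y - x)\<bar> \<le> 651 * (norm (y - x))\<^sup>2"
        using norm_sums_le[OF sums bound] F_rem by simp
    qed
    show "651-lipschitz_on UNIV g"
    proof (rule lipschitz_onI)
      fix x y
      have "(norm (g x - g y))\<^sup>2 \<le> 651\<^sup>2 * (norm (x - y))\<^sup>2"
      proof (rule sums_le)
        show "(\<lambda>n. (norm (block n (g x - g y)))\<^sup>2) sums (norm (g x - g y))\<^sup>2"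
          by (rule block_norm_sums)
        show "(\<lambda>n. 651\<^sup>2 * (norm (block n (x - y)))\<^sup>2) sums (651\<^sup>2 * (norm (x - y))\<^sup>2)"
          by (rule sums_mult[OF block_norm_sums])
        show "(norm (block n (g x - g y)))\<^sup>2 \<le> 651\<^sup>2 * (norm (block n (x - y)))\<^sup>2" for n
          using power_mono[OF H_lip[of n "block n x" "block n y"], of 2]
          by (simp only: block_simps g power_mult_distrib norm_ge_zero)
      qed
      then have "norm (g x - g y) \<le> 651 * norm (x - y)"
        by (rule power2_le_imp_le[OF ord_le_eq_trans]) (simp_all add: power_mult_distrib)
      then show "dist (g x) (g y) \<le> 651 * dist x y" by (simp add: dist_norm)
    qed simp
    show "\<bar>2 * \<Phi> x - (norm x)\<^sup>2\<bar> \<le> \<kappa>" for x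
    proof -
      have sums: "(\<lambda>n. F n (block n x) - (norm (block n x))\<^sup>2 / 2) sums (\<Phi> x - (norm x)\<^sup>2 / 2)"
        by (intro sums_diff F_sums half_sums)
      have bound: "(\<lambda>n. 16 * s n) sums (\<kappa> / 2)"
        using sums_mult[OF s_sums, of 16] by simp
      have "\<bar>\<Phi> x - (norm x)\<^sup>2 / 2\<bar> \<le> \<kappa> / 2"
        using norm_sums_le[OF sums bound] F_close by simp
      then show ?thesis by linarith
    qed
    show "block n (g x) \<noteq> 0" for x n by (simp add: g H_nz)
  qed
qed

section \<open>Approximation of the norm\<close>

text \<open>With \<open>\<kappa> = \<delta>\<^sup>2 / 3\<close>, the radicand
  \<open>2 * \<Phi> x + 2 * \<kappa>\<close> lies between |x|^2 + \<kappa> and |x|^2 + 3 \<kappa>.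
  The lower margin keeps the root away from 0, hence smooth; the upper bound gives the error
  \<delta>.\<close>

lemma exists_smooth_approx_norm:
  assumes "\<delta> > 0"
  obtains \<psi> :: "l2 \<Rightarrow> real" and G L M where
    "\<And>x. (\<psi> has_derivative (\<lambda>h. inner (G x) h)) (at x)"
    "L-lipschitz_on UNIV \<psi>" "M-lipschitz_on UNIV G" "\<And>x. norm (G x) \<le> L"
    "\<And>x. \<bar>\<psi> x - norm x\<bar> \<le> \<delta>" "\<And>x n. block n (G x) \<noteq> 0"
proof -
  define \<kappa> where "\<kappa> = \<delta>\<^sup>2 / 3"
  have kappa: "\<kappa> > 0" using assms by (simp add: \<kappa>_def)
  obtain \<Phi> :: "l2 \<Rightarrow> real" and g M where
    der: "\<And>x. (\<Phi> has_derivative (\<lambda>h. inner (g x) h)) (at x)" and lip: "M-lipschitz_on UNIV g"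
    and close: "\<And>x. \<bar>2 * \<Phi> x - (norm x)\<^sup>2\<bar> \<le> \<kappa>" and nz: "\<And>x n. block n (g x) \<noteq> 0"
    using exists_smooth_approx_half_square[OF kappa] by blast
  define \<psi> where "\<psi> x = sqrt (2 * \<Phi> x + 2 * \<kappa>)" for x
  define G where "G x = inverse (\<psi> x) *\<^sub>R g x" for x
  have sq: "(norm x)\<^sup>2 + \<kappa> \<le> 2 * \<Phi> x + 2 * \<kappa>" "2 * \<Phi> x + 2 * \<kappa> \<le> (norm x)\<^sup>2 + \<delta>\<^sup>2" for x
    using close[of x] unfolding \<kappa>_def by linarith+
  have pos: "0 < 2 * \<Phi> x + 2 * \<kappa>" for x
    using sq(1)[of x] kappa zero_le_power2[of "norm x"] by linarith
  have psi_ge: "norm x \<le> \<psi> x" "sqrt \<kappa> \<le> \<psi> x" for x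
  proof -
    have "(norm x)\<^sup>2 \<le> 2 * \<Phi> x + 2 * \<kappa>" using sq(1)[of x] kappa by linarith
    then show "norm x \<le> \<psi> x" unfolding \<psi>_def by (rule real_le_rsqrt)
    have "\<kappa> \<le> 2 * \<Phi> x + 2 * \<kappa>" using sq(1)[of x] zero_le_power2[of "norm x"] by linarith
    then show "sqrt \<kappa> \<le> \<psi> x" unfolding \<psi>_def by (rule real_sqrt_le_mono)
  qed
  have psi_pos: "\<psi> x > 0" for x using pos[of x] by (simp add: \<psi>_def)
  have psi_le: "\<psi> x \<le> norm x + \<delta>" for x
    unfolding \<psi>_def
  proof (rule real_le_lsqrt)
    have "0 \<le> norm x * \<delta>" using assms by simp
    then show "2 * \<Phi> x + 2 * \<kappa> \<le> (norm x + \<delta>)\<^sup>2"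
      using sq(2)[of x] by (simp add: power2_sum)
  qed (use assms in auto)
  have psi_der: "(\<psi> has_derivative (\<lambda>h. inner (G x) h)) (at x)" for x
    unfolding \<psi>_def[abs_def] G_def using pos[of x]
    by (auto intro!: derivative_eq_intros der simp: fun_eq_iff field_simps)
  \<comment> \<open>The gradient \<open>g\<close> grows at most linearly and \<psi> dominates both
    \<open>norm x\<close> and \<open>sqrt \<kappa>\<close>, so this \<open>B\<close> bounds the
    quotient \<open>G\<close>.\<close>
  define B where "B = norm (g 0) / sqrt \<kappa> + M"
  have M: "M \<ge> 0" by (rule lipschitz_on_nonneg[OF lip])
  have g_bound: "norm (g x) \<le> B * \<psi> x" for x
  proof -
    have "norm (g x) \<le> norm (g 0) + M * norm x"
      using lipschitz_onD[OF lip, of x 0] norm_triangle_sub[of "g x" "g 0"] by (simp add: dist_norm)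
    also have "norm (g 0) \<le> norm (g 0) / sqrt \<kappa> * \<psi> x"
      using mult_right_mono[OF psi_ge(2)[of x], of "norm (g 0)"] kappa by (simp add: field_simps)
    also have "M * norm x \<le> M * \<psi> x" using M psi_ge(1) by (rule mult_left_mono[rotated])
    finally show ?thesis by (simp add: B_def algebra_simps)
  qed
  have G_bound: "norm (G x) \<le> B" for x
    using g_bound[of x] psi_pos[of x] by (simp add: G_def field_simps)
  have psi_lip: "B-lipschitz_on UNIV \<psi>"
    by (rule lipschitz_on_of_bounded_gradient[OF psi_der G_bound])
  have B: "B \<ge> 0" by (rule lipschitz_on_nonneg[OF psi_lip])
  have G_lip: "((M + B * B) / sqrt \<kappa>)-lipschitz_on UNIV G"
  proof (rule lipschitz_onI)
    show "0 \<le> (M + B * B) / sqrt \<kappa>" using M B kappa by simp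
    fix x y
    \<comment> \<open>This form of the quotient difference involves only Lipschitz differences and
      the bounded \<open>G y\<close>, never the unbounded \<open>g y\<close> alone.\<close>
    have "G x - G y = inverse (\<psi> x) *\<^sub>R ((g x - g y) + (\<psi> y - \<psi> x) *\<^sub>R G y)"
      using psi_pos[of x] psi_pos[of y] by (simp add: G_def algebra_simps)
    then have "norm (G x - G y) = inverse (\<psi> x) * norm ((g x - g y) + (\<psi> y - \<psi> x) *\<^sub>R G y)"
      using psi_pos[of x] by simp
    also have "\<dots> \<le> inverse (sqrt \<kappa>) * (M * dist x y + (B * dist x y) * B)"
    proof (rule mult_mono)
      show "inverse (\<psi> x) \<le> inverse (sqrt \<kappa>)"
        using psi_ge(2)[of x] kappa by (intro le_imp_inverse_le) auto
      have "norm ((g x - g y) + (\<psi> y - \<psi> x) *\<^sub>R G y) \<le> norm (g x - g y) + \<bar>\<psi> y - \<psi> x\<bar> * norm (G y)"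
        by (metis norm_triangle_ineq norm_scaleR)
      also have "\<dots> \<le> M * dist x y + (B * dist x y) * B"
        using lipschitz_onD[OF lip, of x y] lipschitz_onD[OF psi_lip, of x y] B
        by (intro add_mono mult_mono G_bound) (auto simp: dist_norm abs_minus_commute)
      finally show "norm ((g x - g y) + (\<psi> y - \<psi> x) *\<^sub>R G y) \<le> M * dist x y + (B * dist x y) * B" .
    qed (use kappa in auto)
    finally show "dist (G x) (G y) \<le> (M + B * B) / sqrt \<kappa> * dist x y"
      by (simp add: dist_norm field_simps)
  qed
  have "\<bar>\<psi> x - norm x\<bar> \<le> \<delta>" for x
    using psi_ge(1)[of x] psi_le[of x] by simp
  moreover have "block n (G x) \<noteq> 0" for x n
    using nz[of n x] psi_pos[of x] by (simp add: G_def block_simps)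
  ultimately show thesis
    using that[OF psi_der psi_lip G_lip G_bound] by blast
qed

section \<open>The bump function\<close>

lemma has_real_derivative_max_0_power2:
  "((\<lambda>t::real. (max 0 t)\<^sup>2) has_derivative (\<lambda>h. inner (2 * max 0 t) h)) (at t)"
proof (rule has_derivative_of_quadratic_remainder)
  fix y :: real
  consider "y \<ge> 0" "t \<ge> 0" | "y < 0" "t < 0" | "y \<ge> 0" "t < 0" | "y < 0" "t \<ge> 0"
    by linarith
  then show "\<bar>(max 0 y)\<^sup>2 - (max 0 t)\<^sup>2 - inner (2 * max 0 t) (y - t)\<bar> \<le> 1 * (norm (y - t))\<^sup>2"
  proof cases
    case 1
    then have "(max 0 y)\<^sup>2 - (max 0 t)\<^sup>2 - inner (2 * max 0 t) (y - t) = (y - t)\<^sup>2"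
      by (simp add: power2_eq_square algebra_simps)
    then show ?thesis by simp
  next
    case 3
    then show ?thesis using power_mono[of y "y - t" 2] by simp
  next
    case 4
    then have "(max 0 y)\<^sup>2 - (max 0 t)\<^sup>2 - inner (2 * max 0 t) (y - t) = (y - t)\<^sup>2 - y\<^sup>2"
      by (simp add: power2_eq_square algebra_simps)
    moreover have "y\<^sup>2 \<le> (y - t)\<^sup>2" using 4 power_mono[of "- y" "t - y" 2]
      by (simp add: power2_commute)
    ultimately show ?thesis by simp
  qed simp
qed

lemma exists_critical_free_bump:
  obtains b :: "l2 \<Rightarrow> real" and G L M where
    "\<And>x. (b has_derivative (\<lambda>h. inner (G x) h)) (at x)"
    "L-lipschitz_on UNIV b" "M-lipschitz_on UNIV G" "is_bump b"
    "interior (deriv_cone G) = {}" "\<And>x. x \<in> interior (fsupport b) \<Longrightarrow> G x \<noteq> 0"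
proof -
  obtain \<psi> :: "l2 \<Rightarrow> real" and G L M where
    der: "\<And>x. (\<psi> has_derivative (\<lambda>h. inner (G x) h)) (at x)" and
    lip: "L-lipschitz_on UNIV \<psi>" and lipG: "M-lipschitz_on UNIV G" and
    bound: "\<And>x. norm (G x) \<le> L" and
    close: "\<And>x. \<bar>\<psi> x - norm x\<bar> \<le> 1" and nz: "\<And>x n. block n (G x) \<noteq> 0"
    using exists_smooth_approx_norm[of 1] by (metis zero_less_one)
  have G_nz: "G x \<noteq> 0" for x using nz[of 0 x] by (auto simp: block_simps)
  \<comment> \<open>The level 2 lies above \<open>\<psi> 0 \<le> 1\<close>, so the bump is nonzero
    at 0; the error bound 1 confines \<open>\<psi> x < 2\<close> to
    \<open>norm x \<le> 3\<close>.\<close>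
  define m where "m x = max 0 (2 - \<psi> x)" for x
  define b where "b x = (m x)\<^sup>2" for x
  define D where "D x = (- 2 * m x) *\<^sub>R G x" for x
  have cont: "continuous_on UNIV \<psi>"
    by (rule lipschitz_on_continuous_on[OF lip])
  have m_bound: "\<bar>- 2 * m x\<bar> \<le> 6" for x
  proof -
    have "\<psi> x \<ge> -1" using close[of x] norm_ge_zero[of x] by linarith
    then show ?thesis by (simp add: m_def)
  qed
  have b_der: "(b has_derivative (\<lambda>h. inner (D x) h)) (at x)" for x
  proof -
    have "((\<lambda>x. 2 - \<psi> x) has_derivative (\<lambda>h. - inner (G x) h)) (at x)"
      by (auto intro!: derivative_eq_intros der)
    from has_derivative_compose[OF this has_real_derivative_max_0_power2]
    show ?thesis by (simp add: b_def[abs_def] m_def D_def mult.assoc)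
  qed
  have "(2 * L)-lipschitz_on UNIV (\<lambda>x. - 2 * m x)"
  proof (rule lipschitz_onI)
    show "dist (- 2 * m x) (- 2 * m y) \<le> 2 * L * dist x y" for x y
      using lipschitz_onD[OF lip, of x y] by (auto simp: m_def dist_real_def max_def)
    show "0 \<le> 2 * L" using lipschitz_on_nonneg[OF lip] by simp
  qed
  then have D_lip: "(6 * M + 2 * L * L)-lipschitz_on UNIV D"
    unfolding D_def[abs_def] using m_bound lipG bound by (rule lipschitz_on_scaleR_bounded)
  have "norm (D x) \<le> 6 * L" for x
    unfolding D_def norm_scaleR using m_bound bound by (rule mult_mono) auto
  then have b_lip: "(6 * L)-lipschitz_on UNIV b"
    by (rule lipschitz_on_of_bounded_gradient[OF b_der])
  have supp: "{x. b x \<noteq> 0} = {x. \<psi> x < 2}"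
    by (auto simp: b_def m_def max_def)
  have "\<psi> 0 < 2" using close[of 0] by simp
  moreover have "bounded {x. \<psi> x < 2}"
  proof (rule boundedI)
    show "norm x \<le> 3" if "x \<in> {x. \<psi> x < 2}" for x
      using that close[of x] by (simp add: abs_le_iff)
  qed
  ultimately have bump: "is_bump b"
    unfolding is_bump_def fsupport_def supp using supp by blast
  have empty: "interior (deriv_cone D) = {}"
  proof (rule empty_interior_of_blocks_nonzero)
    fix z assume "z \<in> deriv_cone D"
    then obtain c x where "z = c *\<^sub>R D x"
      by (auto simp: deriv_cone_def)
    then have "block n z = (c * (- 2 * m x)) *\<^sub>R block n (G x)" "z = (c * (- 2 * m x)) *\<^sub>R G x" for n
      by (simp_all only: D_def block_simps scaleR_scaleR)
    \<comment> \<open>\<open>D x\<close> is a possibly zero multiple of \<open>G x\<close>; a zero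
      coefficient gives \<open>z = 0\<close>, any other preserves the nonvanishing of all
      blocks.\<close>
    then show "z = 0 \<or> (\<forall>n. block n z \<noteq> 0)"
      using nz[of _ x] by (cases "c * (- 2 * m x) = 0") auto
  qed
  \<comment> \<open>A point of the level set \<open>\<psi> = 2\<close> is not interior to the support: there \<open>\<psi>\<close> would have
    a local maximum, so \<open>G\<close> would vanish.\<close>
  have inside: "D x \<noteq> 0" if "x \<in> interior (fsupport b)" for x
  proof -
    have "closure {x. \<psi> x < 2} \<subseteq> {x. \<psi> x \<le> 2}"
      by (rule closure_minimal) (auto intro!: closed_Collect_le cont continuous_intros)
    then have le: "\<psi> y \<le> 2" if "y \<in> interior (fsupport b)" for y
      using that interior_subset unfolding fsupport_def supp by blast
    have "\<psi> x \<noteq> 2"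
    proof
      assume "\<psi> x = 2"
      then have "(\<lambda>h. inner (G x) h) = (\<lambda>h. 0)"
        using le that by (intro differential_zero_maxmin[OF that open_interior der]) auto
      then have "inner (G x) (G x) = 0" by metis
      then show False using G_nz by simp
    qed
    then have "m x \<noteq> 0" using le[OF that] by (simp add: m_def)
    then show ?thesis using G_nz by (simp add: D_def)
  qed
  show thesis by (rule that[OF b_der b_lip D_lip bump empty inside])
qed

theorem theorem4p3:
  shows "(\<forall>\<delta>>0. \<exists>(\<psi>::l2 \<Rightarrow> real) G L M.
            (\<forall>x. (\<psi> has_derivative (\<lambda>h. inner (G x) h)) (at x)) \<and>
            L-lipschitz_on UNIV \<psi> \<and> M-lipschitz_on UNIV G \<and>
            (\<forall>x. \<bar>\<psi> x - norm x\<bar> \<le> \<delta>) \<and>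
            (\<forall>x. G x \<noteq> 0) \<and>
            interior (deriv_cone G) = {})
       \<and> (\<exists>(b::l2 \<Rightarrow> real) G L M.
            (\<forall>x. (b has_derivative (\<lambda>h. inner (G x) h)) (at x)) \<and>
            L-lipschitz_on UNIV b \<and> M-lipschitz_on UNIV G \<and>
            is_bump b \<and>
            interior (deriv_cone G) = {} \<and>
            (\<forall>x\<in>interior (fsupport b). G x \<noteq> 0))"
proof (intro conjI allI impI)
  fix \<delta> :: real assume "\<delta> > 0"
  then obtain \<psi> :: "l2 \<Rightarrow> real" and G L M where
    "\<And>x. (\<psi> has_derivative (\<lambda>h. inner (G x) h)) (at x)"
    "L-lipschitz_on UNIV \<psi>" "M-lipschitz_on UNIV G" "\<And>x. \<bar>\<psi> x - norm x\<bar> \<le> \<delta>"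
    and nz: "\<And>x n. block n (G x) \<noteq> 0"
    using exists_smooth_approx_norm by metis
  moreover have "G x \<noteq> 0" for x using nz[of 0 x] by (auto simp: block_simps)
  moreover have "interior (deriv_cone G) = {}"
  proof (rule empty_interior_of_blocks_nonzero)
    fix z assume "z \<in> deriv_cone G"
    then obtain c x where "z = c *\<^sub>R G x" by (auto simp: deriv_cone_def)
    then show "z = 0 \<or> (\<forall>n. block n z \<noteq> 0)"
      using nz[of _ x] by (cases "c = 0") (auto simp: block_simps)
  qed
  ultimately show "\<exists>(\<psi>::l2 \<Rightarrow> real) G L M.
      (\<forall>x. (\<psi> has_derivative (\<lambda>h. inner (G x) h)) (at x)) \<and>
      L-lipschitz_on UNIV \<psi> \<and> M-lipschitz_on UNIV G \<and>
      (\<forall>x. \<bar>\<psi> x - norm x\<bar> \<le> \<delta>) \<and> (\<forall>x. G x \<noteq> 0) \<and> interior (deriv_cone G) = {}"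
    by blast
next
  show "\<exists>(b::l2 \<Rightarrow> real) G L M.
      (\<forall>x. (b has_derivative (\<lambda>h. inner (G x) h)) (at x)) \<and>
      L-lipschitz_on UNIV b \<and> M-lipschitz_on UNIV G \<and> is_bump b \<and>
      interior (deriv_cone G) = {} \<and> (\<forall>x\<in>interior (fsupport b). G x \<noteq> 0)"
    by (rule exists_critical_free_bump) blast
qed

end
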